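(* Let $n\ge3$ and let $\mathbf w=[w_1,w_2,\dots]$ be an infinite sequence in $\{1,\dots,n\}$ with $w_{t+1}\ne w_t$ for all $t$, in which every index occurs infinitely often. Let $(k_t)_{t\ge1}$ be a sequence of positive real numbers bounded above by some constant $k_c>0$. Let ${}_0x\in\mathbb{Z}_{>0}^n$ and ${}_0y\in\mathbb{R}_{\ge0}^n$, and define ${}_{t+1}x=\mathcal M_{w_{t+1};0}({}_tx)$ (classical Euclid sequence) and ${}_{t+1}y=\mathcal M_{w_{t+1};k_{t+1}}({}_ty)$ (deformed Euclid sequence). Then there exists a real number $q$ such that ${}_ty_j/{}_tx_j\to q$ as $t\to\infty$ for every $j\in\{1,\dots,n\}$; i.e. the deformed Euclid sequence is asymptotic to $q$ times the classical Euclid sequence.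
   Context: For $k\ge 0$ and $i\in\{1,\dots,n\}$, $\mathcal M_{i;k}(z_1,\dots,z_n)$ is obtained from $(z_1,\dots,z_n)$ by replacing $z_i$ with $z_1+\cdots+\widehat{z_i}+\cdots+z_n+k$ (omitting $z_i$ from the sum) and keeping the other coordinates. *)

theory Defs
  imports "HOL-Analysis.Analysis"
begin

text \<open>The index set $\{1,\dots,n\}$ is rendered by a finite type \<open>'n\<close> with \<open>n = CARD('n)\<close>.
  The coefficient type is left open so that the same map acts on integer and on real vectors.\<close>

definition euclid_move :: "'n::finite \<Rightarrow> 'a::comm_monoid_add \<Rightarrow> 'a ^ 'n \<Rightarrow> 'a ^ 'n" where
  "euclid_move i k z = (\<chi> j. if j = i then (\<Sum>l\<in>UNIV - {i}. z $ l) + k else z $ j)"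

text \<open>The sequences \<open>w\<close> and \<open>k\<close> are indexed from 1, so that \<open>w 0\<close> and \<open>k 0\<close> are never used.
  The classical Euclid sequence is the case in which \<open>k\<close> is constantly 0.\<close>

primrec euclid_seq ::
  "(nat \<Rightarrow> 'n::finite) \<Rightarrow> (nat \<Rightarrow> 'a::comm_monoid_add) \<Rightarrow> 'a ^ 'n \<Rightarrow> nat \<Rightarrow> 'a ^ 'n" where
  "euclid_seq w k z 0 = z"
| "euclid_seq w k z (Suc t) = euclid_move (w (Suc t)) (k (Suc t)) (euclid_seq w k z t)"

end

theory Submission
  imports Defs
begin

text \<open>Write \<open>x\<close> and \<open>y\<close> for the classical and the deformed sequence and put
  \<open>a = k_c / (n - 2)\<close>. A step replaces \<open>y\<^sub>i / x\<^sub>i\<close> by at least a convex combination of the other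
  ratios, and \<open>(y\<^sub>i + a) / x\<^sub>i\<close> by at most one, so \<open>L = min y\<^sub>j / x\<^sub>j\<close> increases and
  \<open>U = max (y\<^sub>j + a) / x\<^sub>j\<close> decreases. The gap \<open>U - L\<close> is halved, up to an error tending to 0:
  wait until every index has been replaced, and let \<open>s\<close> be the index whose last replacement, at
  time \<open>\<tau>\<close>, is the oldest. At time \<open>\<tau>\<close> the entry \<open>x\<^sub>s\<close> equals the sum of all the others, so in
  every later average the entries not yet replaced since \<open>\<tau>\<close> weigh no more than \<open>s\<close> does. Hence
  all new ratios are pulled at least half of the way from \<open>L\<close>, and from \<open>U\<close>, to the ratio of \<open>s\<close>.\<close>

section \<open>Comparison for the recursion without additive constant\<close>

definition supersolution :: "(nat \<Rightarrow> 'n::finite) \<Rightarrow> (nat \<Rightarrow> 'n \<Rightarrow> real) \<Rightarrow> bool" where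
  "supersolution w g \<longleftrightarrow>
     (\<forall>t j. g (Suc t) j \<ge> (if j = w (Suc t) then \<Sum>l\<in>UNIV - {j}. g t l else g t j))"

definition solution :: "(nat \<Rightarrow> 'n::finite) \<Rightarrow> (nat \<Rightarrow> 'n \<Rightarrow> real) \<Rightarrow> bool" where
  "solution w x \<longleftrightarrow>
     (\<forall>t j. x (Suc t) j = (if j = w (Suc t) then \<Sum>l\<in>UNIV - {j}. x t l else x t j))"

lemma supersolution_replaced:
  "supersolution w g \<Longrightarrow> j = w (Suc t) \<Longrightarrow> (\<Sum>l\<in>UNIV - {j}. g t l) \<le> g (Suc t) j"
  unfolding supersolution_def by (drule spec[of _ t], drule spec[of _ j]) simp

lemma supersolution_kept:
  "supersolution w g \<Longrightarrow> j \<noteq> w (Suc t) \<Longrightarrow> g t j \<le> g (Suc t) j"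
  unfolding supersolution_def by (drule spec[of _ t], drule spec[of _ j]) simp

text \<open>As \<open>x\<close> satisfies the recursion with equality, multiples of either sign may
  be subtracted. Bounds on a ratio \<open>f / x\<close> thus become sign statements about a
  supersolution, and upper bounds for \<open>y\<close> are obtained as lower bounds for a negated
  sequence.\<close>

lemma supersolution_minus_solution:
  assumes "supersolution w f" "solution w x"
  shows "supersolution w (\<lambda>t j. f t j - c * x t j)"
  unfolding supersolution_def
proof (intro allI)
  fix t j
  show "(if j = w (Suc t) then \<Sum>l\<in>UNIV - {j}. f t l - c * x t l else f t j - c * x t j)
      \<le> f (Suc t) j - c * x (Suc t) j"
    using supersolution_replaced[OF assms(1), of j t] supersolution_kept[OF assms(1), of j t]
      assms(2)[unfolded solution_def, rule_format, of t j]
    by (simp add: sum_subtractf flip: sum_distrib_left)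
qed

lemma supersolution_nonneg_mono:
  assumes "supersolution w f" "\<forall>j. f T j \<ge> 0" "T \<le> t"
  shows "f t j \<ge> 0"
  using assms(3)
proof (induction t arbitrary: j rule: dec_induct)
  case base
  then show ?case using assms(2) by blast
next
  case (step t)
  show ?case
  proof (cases "j = w (Suc t)")
    case True
    have "0 \<le> (\<Sum>l\<in>UNIV - {j}. f t l)" by (intro sum_nonneg step.IH)
    then show ?thesis using supersolution_replaced[OF assms(1) True] by linarith
  next
    case False
    then show ?thesis using supersolution_kept[OF assms(1) False] step.IH[of j] by linarith
  qed
qed

text \<open>Here \<open>b\<close> bounds the deficits of the other entries at time
  \<open>\<tau>\<close>, and \<open>s\<close> outweighs their total. Until \<open>s\<close> is
  replaced its entry cannot drop, so every newly replaced entry, being at least a sum that contains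
  the one of \<open>s\<close>, is nonnegative; the entries still waiting keep their own
  bound.\<close>

lemma supersolution_nonneg_of_dominant:
  assumes sup: "supersolution w g"
    and b: "\<And>l. b l \<ge> 0" "\<And>l. l \<noteq> s \<Longrightarrow> - b l \<le> g \<tau> l" "(\<Sum>l\<in>UNIV - {s}. b l) \<le> g \<tau> s"
    and "\<tau> \<le> t" "s \<notin> w ` {\<tau><..t}"
  shows "g t s \<ge> g \<tau> s \<and> (\<forall>j. j \<noteq> s \<longrightarrow> - b j \<le> g t j \<and> (j \<in> w ` {\<tau><..t} \<longrightarrow> 0 \<le> g t j))"
  using assms(5,6)
proof (induction t rule: dec_induct)
  case base
  then show ?case using b by auto
next
  case (step t)
  have iv: "{\<tau><..Suc t} = insert (Suc t) {\<tau><..t}" using step.hyps by auto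
  have ns: "s \<noteq> w (Suc t)" and "s \<notin> w ` {\<tau><..t}" using step.prems unfolding iv by auto
  then have IH: "g \<tau> s \<le> g t s" "\<And>j. j \<noteq> s \<Longrightarrow> - b j \<le> g t j"
      "\<And>j. j \<noteq> s \<Longrightarrow> j \<in> w ` {\<tau><..t} \<Longrightarrow> 0 \<le> g t j"
    using step.IH by auto
  have new: "0 \<le> g (Suc t) (w (Suc t))"
  proof -
    let ?j = "w (Suc t)"
    have "(\<Sum>l\<in>UNIV - {?j} - {s}. b l) \<le> (\<Sum>l\<in>UNIV - {s}. b l)"
      by (rule sum_mono2) (use b in auto)
    moreover have "- (\<Sum>l\<in>UNIV - {?j} - {s}. b l) \<le> (\<Sum>l\<in>UNIV - {?j} - {s}. g t l)"
      unfolding sum_negf[symmetric] by (rule sum_mono) (use IH in auto)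
    moreover have "(\<Sum>l\<in>UNIV - {?j}. g t l) = g t s + (\<Sum>l\<in>UNIV - {?j} - {s}. g t l)"
      by (rule sum.remove) (use ns in auto)
    ultimately show ?thesis
      using supersolution_replaced[OF sup refl, of t] IH(1) b(3) by linarith
  qed
  show ?case
  proof (intro conjI allI impI)
    show "g \<tau> s \<le> g (Suc t) s" using supersolution_kept[OF sup ns] IH(1) by linarith
  next
    fix j assume j: "j \<noteq> s"
    show "- b j \<le> g (Suc t) j"
    proof (cases "j = w (Suc t)")
      case True
      then show ?thesis using new b(1)[of j] by simp
    next
      case False
      then show ?thesis using supersolution_kept[OF sup False] IH(2)[OF j] by linarith
    qed
  next
    fix j assume j: "j \<noteq> s" "j \<in> w ` {\<tau><..Suc t}"
    show "0 \<le> g (Suc t) j"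
    proof (cases "j = w (Suc t)")
      case True
      then show ?thesis using new by simp
    next
      case False
      then have "j \<in> w ` {\<tau><..t}" using j(2) unfolding iv by auto
      then show ?thesis using supersolution_kept[OF sup False] IH(3)[OF j(1)] by linarith
    qed
  qed
qed

lemma supersolution_half_ratio:
  assumes f: "supersolution w f" "\<forall>j. f \<sigma> j \<ge> 0"
    and x: "solution w x" "\<And>t j. x t j > 0"
    and s: "s = w (Suc \<sigma>)" "Suc \<sigma> \<le> t" "s \<notin> w ` {Suc \<sigma><..t}" "\<And>j. j \<noteq> s \<Longrightarrow> j \<in> w ` {Suc \<sigma><..t}"
  shows "f t j / x t j \<ge> (f (Suc \<sigma>) s / x (Suc \<sigma>) s) / 2"
proof -
  let ?\<tau> = "Suc \<sigma>"
  \<comment> \<open>Half of the ratio is chosen because \<open>f\<close> at \<open>s\<close> then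
    equals \<open>2 * c * x\<close>: after subtraction \<open>c * x\<close> is left there, which is
    exactly the sum of the deficits \<open>c * x\<close> allowed to the others.\<close>
  define c where "c = (f ?\<tau> s / x ?\<tau> s) / 2"
  define g where "g = (\<lambda>t j. f t j - c * x t j)"
  have pos: "0 \<le> f ?\<tau> l" for l
    by (rule supersolution_nonneg_mono[OF f]) simp
  have c: "c \<ge> 0" unfolding c_def using pos x(2)[of ?\<tau> s] by simp
  \<comment> \<open>The step to \<open>?\<tau>\<close> changes only entry \<open>s\<close>, so the
    summands that define the new entry may be read at \<open>?\<tau>\<close> itself.\<close>
  have sum: "x ?\<tau> s = (\<Sum>l\<in>UNIV - {s}. x ?\<tau> l)"
  proof -
    have "x ?\<tau> s = (\<Sum>l\<in>UNIV - {s}. x \<sigma> l)" using x(1) s(1) unfolding solution_def by simp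
    also have "\<dots> = (\<Sum>l\<in>UNIV - {s}. x ?\<tau> l)"
      by (rule sum.cong) (use x(1) s(1) in \<open>auto simp: solution_def\<close>)
    finally show ?thesis .
  qed
  have gs: "g ?\<tau> s = c * x ?\<tau> s"
    unfolding g_def c_def using x(2)[of ?\<tau> s] by (simp add: field_simps)
  have "g t s \<ge> g ?\<tau> s \<and> (\<forall>j. j \<noteq> s \<longrightarrow> - (c * x ?\<tau> j) \<le> g t j \<and> (j \<in> w ` {?\<tau><..t} \<longrightarrow> 0 \<le> g t j))"
  proof (rule supersolution_nonneg_of_dominant)
    show "supersolution w g" unfolding g_def by (rule supersolution_minus_solution[OF f(1) x(1)])
    show "0 \<le> c * x ?\<tau> l" for l using c x(2)[of ?\<tau> l] by simp
    show "- (c * x ?\<tau> l) \<le> g ?\<tau> l" for l unfolding g_def using pos[of l] by simp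
    show "(\<Sum>l\<in>UNIV - {s}. c * x ?\<tau> l) \<le> g ?\<tau> s"
      unfolding gs using sum by (simp flip: sum_distrib_left)
  qed (use s in auto)
  moreover have "0 \<le> g ?\<tau> s" unfolding gs using c x(2)[of ?\<tau> s] by simp
  ultimately have "0 \<le> g t j" using s(4)[of j] by (cases "j = s") auto
  then show ?thesis
    unfolding g_def c_def[symmetric] using x(2)[of t j] by (simp add: pos_le_divide_eq)
qed

text \<open>Take \<open>t\<close> so late that all indices occur after \<open>T\<close>, then shrink
  the window from the left as far as it still contains every index. One step further loses an index,
  which can only be \<open>w (Suc \<sigma>)\<close>.\<close>

lemma exists_oldest_index:
  fixes w :: "nat \<Rightarrow> 'n::finite"
  assumes "\<forall>i. infinite {t. t \<ge> 1 \<and> w t = i}"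
  obtains \<sigma> t where "T \<le> \<sigma>" "Suc \<sigma> \<le> t" "w (Suc \<sigma>) \<notin> w ` {Suc \<sigma><..t}"
    "\<And>j. j \<noteq> w (Suc \<sigma>) \<Longrightarrow> j \<in> w ` {Suc \<sigma><..t}"
proof -
  have "\<exists>u>T. w u = i" for i
    using assms[rule_format, of i] unfolding infinite_nat_iff_unbounded by auto
  then obtain u where u: "\<And>i. u i > T" "\<And>i. w (u i) = i" by metis
  define t where "t = Max (range u)"
  have t: "u i \<le> t" for i unfolding t_def by simp
  have "i \<in> w ` {T<..t}" for i
    by (rule image_eqI[of _ _ "u i"]) (simp_all add: u t)
  then have full: "w ` {T<..t} = UNIV" by blast
  define P where "P \<sigma> \<longleftrightarrow> w ` {\<sigma><..t} = UNIV" for \<sigma>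
  have less: "\<sigma> < t" if "P \<sigma>" for \<sigma>
    using that unfolding P_def by (rule_tac ccontr) simp
  define \<sigma> where "\<sigma> = (GREATEST \<sigma>. P \<sigma>)"
  have P: "P \<sigma>" unfolding \<sigma>_def
    by (rule GreatestI_nat[of P T t]) (use full less in \<open>auto simp: P_def less_imp_le\<close>)
  have le: "\<rho> \<le> \<sigma>" if "P \<rho>" for \<rho> unfolding \<sigma>_def
    by (rule Greatest_le_nat[of P \<rho> t]) (use that less in \<open>auto simp: less_imp_le\<close>)
  have iv: "{\<sigma><..t} = insert (Suc \<sigma>) {Suc \<sigma><..t}" using less[OF P] by auto
  have all: "j = w (Suc \<sigma>) \<or> j \<in> w ` {Suc \<sigma><..t}" for j
    using P unfolding P_def iv by auto
  have "\<not> P (Suc \<sigma>)" using le[of "Suc \<sigma>"] by auto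
  then have "w (Suc \<sigma>) \<notin> w ` {Suc \<sigma><..t}" using all unfolding P_def by (metis UNIV_eq_I)
  then show ?thesis using that[of \<sigma> t] all less[OF P] le[of T] full unfolding P_def by auto
qed

section \<open>Positivity and growth of the classical sequence\<close>

lemma euclid_seq_pos:
  fixes x0 :: "int ^ 'n::finite"
  assumes "CARD('n) \<ge> 2" "\<forall>j. x0 $ j > 0"
  shows "euclid_seq w (\<lambda>_. 0) x0 t $ j > 0"
proof (induction t arbitrary: j)
  case 0
  then show ?case using assms(2) by simp
next
  case (Suc t)
  have "card (UNIV - {w (Suc t)}) \<noteq> 0" using assms(1) by simp
  then have "UNIV - {w (Suc t)} \<noteq> {}" by (metis card.empty)
  then have "0 < (\<Sum>l\<in>UNIV - {w (Suc t)}. euclid_seq w (\<lambda>_. 0) x0 t $ l)"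
    by (intro sum_pos) (use Suc in auto)
  then show ?case using Suc by (simp add: euclid_move_def)
qed

text \<open>The new sum contains the entry replaced just before, since consecutive indices differ,
  and at least one further positive integer, since \<open>n \<ge> 3\<close>; so it grows by at least
  1. This makes the shift \<open>a\<close> negligible against a freshly replaced entry.\<close>

lemma euclid_seq_replaced_ge:
  fixes x0 :: "int ^ 'n::finite"
  assumes n: "CARD('n) \<ge> 3" and w: "\<forall>t\<ge>1. w (t + 1) \<noteq> w t" and x0: "\<forall>j. x0 $ j > 0"
    and "t \<ge> 1"
  shows "euclid_seq w (\<lambda>_. 0) x0 t $ w t \<ge> int t"
  using assms(4)
proof (induction t rule: dec_induct)
  case base
  have "euclid_seq w (\<lambda>_. 0) x0 1 $ w 1 > 0" by (rule euclid_seq_pos) (use n x0 in auto)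
  then show ?case by (simp only: int_one_le_iff_zero_less of_nat_1)
next
  case (step t)
  let ?x = "\<lambda>j. euclid_seq w (\<lambda>_. 0) x0 t $ j"
  let ?A = "UNIV - {w (Suc t)} - {w t}"
  have pos: "?x j > 0" for j using euclid_seq_pos[of x0] n x0 by simp
  have ne: "w t \<noteq> w (Suc t)" using w step.hyps(1) by (metis Suc_eq_plus1)
  have "card ?A = CARD('n) - 2" using ne by (simp add: card_Diff_singleton_if)
  then have "card ?A \<noteq> 0" using n by simp
  then have "?A \<noteq> {}" by (metis card.empty)
  then have "0 < (\<Sum>l\<in>?A. ?x l)" by (intro sum_pos) (use pos in auto)
  moreover have "(\<Sum>l\<in>UNIV - {w (Suc t)}. ?x l) = ?x (w t) + (\<Sum>l\<in>?A. ?x l)"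
    by (rule sum.remove) (use ne in auto)
  ultimately show ?case using step.IH by (simp add: euclid_move_def)
qed

section \<open>Convergence of the ratios\<close>

theorem theorem3p8:
  fixes w :: "nat \<Rightarrow> 'n::finite"
    and k :: "nat \<Rightarrow> real"
    and k_c :: real
    and x0 :: "int ^ 'n"
    and y0 :: "real ^ 'n"
  assumes "CARD('n) \<ge> 3"
    and "\<forall>t\<ge>1. w (t + 1) \<noteq> w t"
    and "\<forall>i. infinite {t. t \<ge> 1 \<and> w t = i}"
    and "k_c > 0"
    and "\<forall>t\<ge>1. 0 < k t \<and> k t \<le> k_c"
    and "\<forall>j. x0 $ j > 0"
    and "\<forall>j. y0 $ j \<ge> 0"
  shows "\<exists>q::real. \<forall>j. (\<lambda>t. euclid_seq w k y0 t $ j /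
           real_of_int (euclid_seq w (\<lambda>_. 0) x0 t $ j)) \<longlonglongrightarrow> q"
proof -
  define x where "x t j = real_of_int (euclid_seq w (\<lambda>_. 0) x0 t $ j)" for t j
  define y where "y t j = euclid_seq w k y0 t $ j" for t j
  \<comment> \<open>With this value the shifts of the \<open>n - 1\<close> summands add up to
    \<open>a + k_c\<close>, the shift of the new entry plus the largest possible \<open>k t\<close>;
    hence \<open>- (y + a)\<close> is a supersolution.\<close>
  define a where "a = k_c / (real CARD('n) - 2)"
  have a: "a > 0" "(real CARD('n) - 1) * a = a + k_c"
    unfolding a_def using assms(1,4) by (auto simp: field_simps)
  have xpos: "x t j > 0" for t j
    unfolding x_def using euclid_seq_pos[of x0] assms(1,6) by simp
  have sol: "solution w x"
    unfolding solution_def x_def by (simp add: euclid_move_def)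
  have step_y: "y (Suc t) j = (if j = w (Suc t) then (\<Sum>l\<in>UNIV - {j}. y t l) + k (Suc t) else y t j)"
    for t j unfolding y_def by (simp add: euclid_move_def)
  have kb: "0 < k (Suc t)" "k (Suc t) \<le> k_c" for t using assms(5) by auto
  have ysup: "supersolution w y"
    unfolding supersolution_def using step_y kb by (auto simp: less_imp_le)
  have zsup: "supersolution w (\<lambda>t j. - (y t j + a))"
    unfolding supersolution_def
  proof (intro allI)
    fix t j
    have "(\<Sum>l\<in>UNIV - {j}. - (y t l + a)) = - (\<Sum>l\<in>UNIV - {j}. y t l) - (real CARD('n) - 1) * a"
      by (simp add: sum_negf sum_subtractf of_nat_diff)
    then show "(if j = w (Suc t) then \<Sum>l\<in>UNIV - {j}. - (y t l + a) else - (y t j + a))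
        \<le> - (y (Suc t) j + a)"
      using kb[of t] a(2) by (auto simp: step_y)
  qed
  define r where "r t j = y t j / x t j" for t j
  define u where "u t j = (y t j + a) / x t j" for t j
  define L where "L t = Min (range (r t))" for t
  define U where "U t = Max (range (u t))" for t
  have Lr: "L t \<le> r t j" and uU: "u t j \<le> U t" for t j unfolding L_def U_def by auto
  have ru: "u t j = r t j + a / x t j" for t j unfolding r_def u_def by (simp add: add_divide_distrib)
  have r_le_u: "r t j \<le> u t j" for t j using ru a(1) xpos[of t j] by simp
  have L_ge: "c \<le> L t" if "\<And>j. c \<le> r t j" for c t unfolding L_def using that by auto
  have U_le: "U t \<le> c" if "\<And>j. u t j \<le> c" for c t unfolding U_def using that by auto
  define f where "f T = (\<lambda>t j. y t j - L T * x t j)" for T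
  \<comment> \<open>The multiplier is \<open>- U T\<close>, so that division by \<open>x\<close>
    leaves \<open>U T - u\<close>, the mirror image of \<open>r - L T\<close>.\<close>
  define h where "h T = (\<lambda>t j. - (y t j + a) - (- U T) * x t j)" for T
  have fsup: "supersolution w (f T)" and hsup: "supersolution w (h T)" for T
    unfolding f_def h_def by (intro supersolution_minus_solution ysup zsup sol)+
  have f_ratio: "f T t j / x t j = r t j - L T" and h_ratio: "h T t j / x t j = U T - u t j" for T t j
    unfolding f_def h_def r_def u_def using xpos[of t j] by (simp_all add: field_simps)
  have f_iff: "0 \<le> f T t j \<longleftrightarrow> L T \<le> r t j" and h_iff: "0 \<le> h T t j \<longleftrightarrow> u t j \<le> U T" for T t j
    unfolding f_def h_def r_def u_def using xpos[of t j] by (simp_all add: field_simps)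
  have f_nonneg: "0 \<le> f T t j" if "T \<le> t" for T t j
    by (rule supersolution_nonneg_mono[OF fsup _ that]) (simp add: f_iff Lr)
  have h_nonneg: "0 \<le> h T t j" if "T \<le> t" for T t j
    by (rule supersolution_nonneg_mono[OF hsup _ that]) (simp add: h_iff uU)
  have L_mono: "L T \<le> L t" if "T \<le> t" for T t
    by (rule L_ge) (use f_nonneg[OF that] f_iff in blast)
  have U_anti: "U t \<le> U T" if "T \<le> t" for T t
    by (rule U_le) (use h_nonneg[OF that] h_iff in blast)
  define D where "D t = U t - L t" for t
  have D_nonneg: "0 \<le> D t" for t
    unfolding D_def using Lr[of t undefined] uU[of t undefined] r_le_u[of t undefined] by linarith
  have "decseq D" unfolding decseq_def D_def by (meson L_mono U_anti diff_mono)
  then obtain d where d: "D \<longlonglongrightarrow> d" "\<And>t. d \<le> D t"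
    using decseq_convergent[of D 0] D_nonneg by blast
  \<comment> \<open>Half of the bound \<open>a / (T + 1)\<close> for \<open>u - r\<close> at an
    entry replaced after time \<open>T\<close>.\<close>
  define e where "e T = a / 2 * inverse (real (Suc T))" for T
  have e: "2 * e T = a / real (Suc T)" for T unfolding e_def by (simp add: field_simps)
  have contract: "d \<le> D T / 2 + e T" for T
  proof -
    obtain \<sigma> t where st: "T \<le> \<sigma>" "Suc \<sigma> \<le> t" "w (Suc \<sigma>) \<notin> w ` {Suc \<sigma><..t}"
      "\<And>j. j \<noteq> w (Suc \<sigma>) \<Longrightarrow> j \<in> w ` {Suc \<sigma><..t}"
      using exists_oldest_index[OF assms(3), of T] by metis
    let ?s = "w (Suc \<sigma>)"
    have "(r (Suc \<sigma>) ?s - L T) / 2 \<le> r t j - L T" for j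
      using supersolution_half_ratio[OF fsup _ sol xpos refl st(2-4), of T j] f_nonneg[OF st(1)]
      by (simp add: f_ratio)
    then have "(r (Suc \<sigma>) ?s + L T) / 2 \<le> L t" by (intro L_ge) (simp add: field_simps)
    moreover have "(U T - u (Suc \<sigma>) ?s) / 2 \<le> U T - u t j" for j
      using supersolution_half_ratio[OF hsup _ sol xpos refl st(2-4), of T j] h_nonneg[OF st(1)]
      by (simp add: h_ratio)
    then have "U t \<le> (U T + u (Suc \<sigma>) ?s) / 2" by (intro U_le) (simp add: field_simps)
    moreover have "a / x (Suc \<sigma>) ?s \<le> a / real (Suc T)"
    proof (rule divide_left_mono)
      have "int (Suc \<sigma>) \<le> euclid_seq w (\<lambda>_. 0) x0 (Suc \<sigma>) $ ?s"
        by (rule euclid_seq_replaced_ge) (use assms in auto)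
      then have "real (Suc \<sigma>) \<le> x (Suc \<sigma>) ?s" unfolding x_def by linarith
      then show "real (Suc T) \<le> x (Suc \<sigma>) ?s" using st(1) by simp
    qed (use a xpos in auto)
    then have "u (Suc \<sigma>) ?s \<le> r (Suc \<sigma>) ?s + 2 * e T"
      unfolding e by (simp only: ru add_left_mono)
    \<comment> \<open>The time \<open>t\<close> depends on \<open>T\<close> without control, so
      \<open>D t\<close> is bounded below by its limit \<open>d\<close>. The two half-way estimates
      differ by \<open>D T / 2\<close> plus half of \<open>u - r\<close> at \<open>?s\<close>, which
      is at most \<open>e T\<close>.\<close>
    moreover have "d \<le> U t - L t" using d(2)[of t] by (simp add: D_def)
    ultimately show ?thesis unfolding D_def by argo
  qed
  have "(\<lambda>T. D T / 2 + e T) \<longlonglongrightarrow> d / 2 + a / 2 * 0"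
    unfolding e_def
    by (intro tendsto_intros d(1) LIMSEQ_inverse_real_of_nat) simp
  then have "d \<le> d / 2" using contract by (intro LIMSEQ_le_const) auto
  moreover have "0 \<le> d" using d(1) D_nonneg by (intro LIMSEQ_le_const) auto
  ultimately have D0: "D \<longlonglongrightarrow> 0" using d(1) by simp
  have "L t \<le> U 0" for t using D_nonneg[of t] U_anti[of 0 t] unfolding D_def by simp
  moreover have "incseq L" unfolding incseq_def using L_mono by blast
  ultimately obtain q where q: "L \<longlonglongrightarrow> q" using incseq_convergent by metis
  have "(\<lambda>t. L t + D t) \<longlonglongrightarrow> q + 0" by (intro tendsto_add q D0)
  then have Uq: "U \<longlonglongrightarrow> q" unfolding D_def by simp
  have "(\<lambda>t. r t j) \<longlonglongrightarrow> q" for j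
    by (rule tendsto_sandwich[OF _ _ q Uq])
      (use Lr order_trans[OF r_le_u uU] in auto)
  then show ?thesis unfolding r_def x_def y_def by blast
qed

end
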